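(* For every integer $n \geq 36$, there is a regular $K_4$-saturated graph on $n$ vertices.
   Context: All graphs are finite and simple. A graph $G$ is $K_4$-saturated if $G$ contains no subgraph isomorphic to $K_4$ (the complete graph on 4 vertices), but adding any edge between two nonadjacent vertices creates a $K_4$. A graph is regular if all its vertices have the same degree. *)

theory Defs
  imports "Graph_Theory.Graph_Theory"
begin

text \<open>
  Finite simple graphs are the values satisfying \<^const>\<open>pair_graph\<close>: finite, loop-free digraphs
  with a symmetric arc relation, so that an edge \<open>uv\<close> is the pair of arcs \<open>(u, v)\<close>, \<open>(v, u)\<close>.
\<close>

text \<open>
  \<^const>\<open>complete_digraph\<close> is closed under isomorphism, so no isomorphism occurs explicitly.
\<close>

definition contains_complete :: "nat \<Rightarrow> 'a pair_pre_digraph \<Rightarrow> bool" where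
  "contains_complete r G \<longleftrightarrow> (\<exists>H. subgraph H (with_proj G) \<and> complete_digraph r H)"

definition add_edge :: "'a pair_pre_digraph \<Rightarrow> 'a \<Rightarrow> 'a \<Rightarrow> 'a pair_pre_digraph" where
  "add_edge G u v = \<lparr> pverts = pverts G, parcs = parcs G \<union> {(u, v), (v, u)} \<rparr>"

definition complete_saturated :: "nat \<Rightarrow> 'a pair_pre_digraph \<Rightarrow> bool" where
  "complete_saturated r G \<longleftrightarrow>
     \<not> contains_complete r G \<and>
     (\<forall>u \<in> pverts G. \<forall>v \<in> pverts G.
        u \<noteq> v \<and> (u, v) \<notin> parcs G \<longrightarrow> contains_complete r (add_edge G u v))"

text \<open>
  In a symmetric digraph the out-degree of a vertex is its number of neighbours, i.e. its degree in
  the undirected graph; \<open>in_degree + out_degree\<close> would count every edge twice.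
\<close>

definition regular_graph :: "'a pair_pre_digraph \<Rightarrow> bool" where
  "regular_graph G \<longleftrightarrow> (\<exists>d. \<forall>v \<in> pverts G. out_degree (with_proj G) v = d)"

lemma pair_graph_add_edge:
  assumes "pair_graph G" "u \<in> pverts G" "v \<in> pverts G" "u \<noteq> v"
  shows "pair_graph (add_edge G u v)"
proof -
  interpret pair_graph G by fact
  show ?thesis
    using assms(2-) pair_finite_verts pair_finite_arcs pair_no_loops
    by unfold_locales (auto simp: add_edge_def symmetric_def intro!: symI dest: arcs_symmetric wellformed')
qed

lemma out_degree_pair: "out_degree (with_proj G) v = card {w. (v, w) \<in> parcs G}"
proof -
  have "out_arcs (with_proj G) v = Pair v ` {w. (v, w) \<in> parcs G}"
    by (auto simp: out_arcs_def)
  then show ?thesis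
    by (simp add: out_degree_def card_image inj_on_def)
qed

end

theory Submission
  imports Defs
begin

text \<open>
  The graph is the circulant on \<open>\<int>/n\<close> with connection set \<open>\<plusminus>[a, 3a - 1]\<close>, which is
  \<open>K\<^sub>4\<close>-saturated whenever \<open>8a - 2 \<le> n \<le> 10a - 3\<close>: the lower bound on \<open>n\<close> excludes a
  \<open>K\<^sub>4\<close>, and the upper bound leaves, for two nonadjacent vertices, room for an adjacent pair of
  common neighbours. For \<open>a \<ge> 4\<close> these intervals of \<open>n\<close> leave no gap.
\<close>

section \<open>Complete subgraphs as cliques of vertices\<close>

lemma contains_complete_iff:
  assumes "pair_graph G"
  shows "contains_complete r G \<longleftrightarrow>
    (\<exists>S \<subseteq> pverts G. card S = r \<and> (\<forall>u \<in> S. \<forall>v \<in> S. u \<noteq> v \<longrightarrow> (u, v) \<in> parcs G))"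
proof
  assume "contains_complete r G"
  then obtain H where H: "subgraph H (with_proj G)" "complete_digraph r H"
    unfolding contains_complete_def by blast
  \<comment> \<open>\<open>compatible\<close> forces the tail and head maps of \<open>H\<close> to
    be the projections, so each arc of \<open>H\<close> is its own pair of ends.\<close>
  then have "arcs_ends H \<subseteq> parcs G"
    by (auto simp: subgraph_def compatible_def arcs_ends_conv)
  moreover have "arcs_ends H = {(u, v). (u, v) \<in> verts H \<times> verts H \<and> u \<noteq> v}"
    "card (verts H) = r"
    using H(2) by (auto simp: complete_digraph_def)
  moreover have "verts H \<subseteq> pverts G"
    using H(1) by (auto simp: subgraph_def)
  ultimately show "\<exists>S \<subseteq> pverts G. card S = r \<and>
      (\<forall>u \<in> S. \<forall>v \<in> S. u \<noteq> v \<longrightarrow> (u, v) \<in> parcs G)"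
    by (intro exI[of _ "verts H"]) auto
next
  interpret pair_graph G by fact
  assume "\<exists>S \<subseteq> pverts G. card S = r \<and> (\<forall>u \<in> S. \<forall>v \<in> S. u \<noteq> v \<longrightarrow> (u, v) \<in> parcs G)"
  then obtain S where S: "S \<subseteq> pverts G" "card S = r"
    "\<And>u v. u \<in> S \<Longrightarrow> v \<in> S \<Longrightarrow> u \<noteq> v \<Longrightarrow> (u, v) \<in> parcs G"
    by blast
  define H where "H = \<lparr>pverts = S, parcs = {(u, v). (u, v) \<in> S \<times> S \<and> u \<noteq> v}\<rparr>"
  have "complete_digraph r (with_proj H)"
    unfolding complete_digraph_pair_def
    using S(1,2) finite_subset[OF S(1) pair_finite_verts] by (simp add: H_def)
  moreover have "subgraph (with_proj H) (with_proj G)"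
    using S unfolding subgraph_def compatible_def
    by (auto simp: H_def wf_digraph_axioms wf_digraph_wp_iff pair_wf_digraph_def)
  ultimately show "contains_complete r G"
    unfolding contains_complete_def by blast
qed

section \<open>Circulant graphs\<close>

definition circulant :: "nat \<Rightarrow> int set \<Rightarrow> nat pair_pre_digraph" where
  "circulant n D = \<lparr>pverts = {..<n},
     parcs = {(u, v). u < n \<and> v < n \<and> (int v - int u) mod int n \<in> D}\<rparr>"

lemma pverts_circulant [simp]: "pverts (circulant n D) = {..<n}"
  by (simp add: circulant_def)

lemma mem_parcs_circulant [simp]:
  "(u, v) \<in> parcs (circulant n D) \<longleftrightarrow> u < n \<and> v < n \<and> (int v - int u) mod int n \<in> D"
  by (simp add: circulant_def)

lemma pair_graph_circulant:
  assumes "0 \<notin> D" and sym: "\<And>k. k \<in> D \<Longrightarrow> (- k) mod int n \<in> D"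
  shows "pair_graph (circulant n D)"
proof
  have "parcs (circulant n D) \<subseteq> {..<n} \<times> {..<n}"
    by auto
  then show "finite (parcs (circulant n D))"
    by (rule finite_subset) simp
  have "(int u - int v) mod int n \<in> D" if "(int v - int u) mod int n \<in> D" for u v
    using sym[OF that] by (simp add: mod_minus_eq)
  then show "symmetric (with_proj (circulant n D))"
    by (auto simp: symmetric_def intro!: symI)
qed (use assms(1) in auto)

text \<open>Translation by -v carries the neighbourhood of v onto \<open>D\<close>. It reaches all
  of \<open>D\<close> because the elements of \<open>D\<close> are reduced residues.\<close>

lemma regular_circulant:
  assumes "D \<subseteq> {0..<int n}"
  shows "regular_graph (circulant n D)"
  unfolding regular_graph_def out_degree_pair
proof (intro exI ballI)
  fix v assume "v \<in> pverts (circulant n D)"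
  then have v: "v < n" by simp
  have "bij_betw (\<lambda>w. (int w - int v) mod int n)
      {w. (v, w) \<in> parcs (circulant n D)} D"
    unfolding bij_betw_def
  proof
    show "inj_on (\<lambda>w. (int w - int v) mod int n) {w. (v, w) \<in> parcs (circulant n D)}"
    proof (rule inj_onI)
      fix w x
      assume *: "w \<in> {w. (v, w) \<in> parcs (circulant n D)}" "x \<in> {w. (v, w) \<in> parcs (circulant n D)}"
        "(int w - int v) mod int n = (int x - int v) mod int n"
      then have "(int w - int v + int v) mod int n = (int x - int v + int v) mod int n"
        by (metis mod_add_left_eq)
      with * show "w = x" by simp
    qed
    show "(\<lambda>w. (int w - int v) mod int n) ` {w. (v, w) \<in> parcs (circulant n D)} = D"
    proof (intro equalityI subsetI)
      fix k assume k: "k \<in> D"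
      let ?w = "nat ((int v + k) mod int n)"
      have "int ?w = (int v + k) mod int n" "?w < n"
        using v by (auto simp: nat_less_iff)
      moreover from this have "(int ?w - int v) mod int n = k"
        using k assms by (auto simp: mod_simps)
      ultimately show "k \<in> (\<lambda>w. (int w - int v) mod int n) ` {w. (v, w) \<in> parcs (circulant n D)}"
        using k v by (intro image_eqI[of _ _ ?w]) auto
    qed auto
  qed
  then show "card {w. (v, w) \<in> parcs (circulant n D)} = card D"
    by (rule bij_betw_same_card)
qed

section \<open>The connection set and the absence of a 4-clique\<close>

definition two_arcs :: "int \<Rightarrow> int \<Rightarrow> int set" where
  "two_arcs a n = {a..3 * a - 1} \<union> {n - 3 * a + 1..n - a}"

lemma uminus_mod_eq_diff: "0 < k \<Longrightarrow> k < n \<Longrightarrow> (- k) mod n = n - k" for k n :: int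
  by (simp add: zmod_zminus1_eq_if)

lemma two_arcs_uminus:
  assumes "0 < a" "3 * a \<le> n" "k \<in> two_arcs a n"
  shows "(- k) mod n \<in> two_arcs a n"
proof -
  have "0 < k" "k < n"
    using assms by (auto simp: two_arcs_def)
  then show ?thesis
    using assms(3) by (auto simp: two_arcs_def uminus_mod_eq_diff)
qed

text \<open>Let g1, ..., g4 be the cyclic gaps y - x, z - y, w - z, n - (w - x). Each is at least a,
  hence at most n - 3a, hence in the first interval and at most 3a - 1. One of g1 + g2, g3 + g4 is
  at most 3a - 1, and likewise one of g2 + g3, g4 + g1. These two short sums share a gap, so
  together they cover three gaps of total at most 2(3a - 1) - a = 5a - 2. With the fourth gap, n
  \<le> 8a - 3, a contradiction.\<close>

lemma two_arcs_no_K4: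
  assumes "0 < a" "8 * a - 2 \<le> n" "x < y" "y < z" "z < w"
    and "y - x \<in> two_arcs a n" "z - x \<in> two_arcs a n" "w - x \<in> two_arcs a n"
      "z - y \<in> two_arcs a n" "w - y \<in> two_arcs a n" "w - z \<in> two_arcs a n"
  shows False
  using assms unfolding two_arcs_def Un_iff atLeastAtMost_iff by linarith

lemma circulant_no_K4:
  assumes "0 < a" "8 * a - 2 \<le> int n" and G: "pair_graph (circulant n (two_arcs a (int n)))"
  shows "\<not> contains_complete 4 (circulant n (two_arcs a (int n)))"
proof
  assume "contains_complete 4 (circulant n (two_arcs a (int n)))"
  then obtain S where S: "S \<subseteq> {..<n}" "card S = 4"
    "\<And>u v. u \<in> S \<Longrightarrow> v \<in> S \<Longrightarrow> u \<noteq> v \<Longrightarrow> (int v - int u) mod int n \<in> two_arcs a (int n)"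
    unfolding contains_complete_iff[OF G] by auto
  have fin: "finite S"
    using S(1) finite_subset by blast
  have "length (sorted_list_of_set S) = Suc (Suc (Suc (Suc 0)))"
    using S(2) by simp
  then obtain x y z w where xs: "sorted_list_of_set S = [x, y, z, w]"
    unfolding length_Suc_conv length_0_conv by blast
  have mem: "S = {x, y, z, w}"
    using set_sorted_list_of_set[OF fin] unfolding xs by simp
  have ord: "x < y" "y < z" "z < w"
    using strict_sorted_list_of_set[of S] unfolding xs by auto
  \<comment> \<open>For u < v < n the difference is already reduced, so in sorted order the modulus
    disappears.\<close>
  have diff: "int v - int u \<in> two_arcs a (int n)" if "u \<in> S" "v \<in> S" "u < v" for u v
    using S(1) S(3)[of u v] that by (auto simp: mod_pos_pos_trivial)
  show False
    by (rule two_arcs_no_K4[of a "int n" "int x" "int y" "int z" "int w"])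
      (use assms(1,2) ord in \<open>auto intro!: diff simp: mem\<close>)
qed

section \<open>Adjacent common neighbours of nonadjacent vertices\<close>

lemma two_arcs_saturating_pair:
  assumes "0 < a" "8 * a - 2 \<le> n" "n \<le> 10 * a - 3"
    and "0 < d" "2 * d \<le> n" "d \<notin> two_arcs a n"
  obtains b c where "b \<in> two_arcs a n" "c \<in> two_arcs a n" "c - b \<in> two_arcs a n"
    "(d - b) mod n \<in> two_arcs a n" "(d - c) mod n \<in> two_arcs a n"
proof -
  have neg: "(- k) mod n \<in> two_arcs a n" if "k \<in> two_arcs a n" for k
    using two_arcs_uminus assms(1,2) that by force
  \<comment> \<open>The two vertices are placed at 0 and d; b and c are to be adjacent to both and
    to each other.\<close>
  consider "d < a" | "3 * a \<le> d" "d < 4 * a - 1" | "4 * a - 1 \<le> d"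
    using assms unfolding two_arcs_def Un_iff atLeastAtMost_iff by linarith
  then show thesis
  proof cases
    case 1
    \<comment> \<open>Both neighbours lie beyond d, at distances a and 2a from it; d \<le> a - 1
      keeps d + 2a within 3a - 1.\<close>
    have "a \<in> two_arcs a n" "2 * a \<in> two_arcs a n" "d + a \<in> two_arcs a n" "d + 2 * a \<in> two_arcs a n"
      using 1 assms by (auto simp: two_arcs_def)
    then show thesis
      using neg[of a] neg[of "2 * a"] by (intro that[of "d + a" "d + 2 * a"]) auto
  next
    case 2
    \<comment> \<open>Both neighbours lie between 0 and d; the case bounds put d - a and d - 2a in
      the first interval.\<close>
    have "(d - a) mod n = d - a" "(d - 2 * a) mod n = d - 2 * a"
      using 2 assms by (auto intro!: mod_pos_pos_trivial)
    then show thesis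
      using 2 assms by (intro that[of a "2 * a"]) (auto simp: two_arcs_def)
  next
    case 3
    \<comment> \<open>Here b and c are mirror images under k -> d - k. Since 2d \<le> n \<le> 10a -
      3 gives d \<le> 5a - 2, the distance c - b = 6a - 2 - d is at least a; d \<ge> 4a - 1 gives b
      \<ge> a.\<close>
    have "(d - (3 * a - 1)) mod n = d - (3 * a - 1)"
      using 3 assms by (intro mod_pos_pos_trivial) auto
    moreover have "(d - (d - (3 * a - 1))) mod n = 3 * a - 1"
      using 3 assms by auto
    ultimately show thesis
      using 3 assms by (intro that[of "d - (3 * a - 1)" "3 * a - 1"]) (auto simp: two_arcs_def)
  qed
qed

lemma circulant_add_edge_K4:
  fixes D :: "int set"
  assumes G: "pair_graph (circulant n D)" and D: "D \<subseteq> {0<..<int n}"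
    and uv: "u < n" "v < n" "u \<noteq> v"
    and bc: "b \<in> D" "c \<in> D" "(c - b) mod int n \<in> D"
      "((int v - int u) - b) mod int n \<in> D" "((int v - int u) - c) mod int n \<in> D"
  shows "contains_complete 4 (add_edge (circulant n D) u v)"
proof -
  interpret G: pair_graph "circulant n D" by (rule G)
  \<comment> \<open>Translation by u takes 0, b, c to u, x, y; the clique is u, v, x, y, with uv the
    new edge.\<close>
  define x where "x = nat ((int u + b) mod int n)"
  define y where "y = nat ((int u + c) mod int n)"
  have n: "0 < int n"
    using uv by simp
  have x: "int x = (int u + b) mod int n" "x < n" and y: "int y = (int u + c) mod int n" "y < n"
    using n by (auto simp: x_def y_def nat_less_iff)
  have "(int x - int u) mod int n = b" "(int y - int u) mod int n = c"
    using bc(1,2) D by (auto simp: x y mod_simps)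
  moreover have "(int y - int x) mod int n = (c - b) mod int n"
    "(int v - int x) mod int n = ((int v - int u) - b) mod int n"
    "(int v - int y) mod int n = ((int v - int u) - c) mod int n"
    by (simp_all add: x y mod_simps algebra_simps)
  ultimately have arcs: "(u, x) \<in> parcs (circulant n D)" "(u, y) \<in> parcs (circulant n D)"
    "(x, y) \<in> parcs (circulant n D)" "(x, v) \<in> parcs (circulant n D)"
    "(y, v) \<in> parcs (circulant n D)"
    using bc uv x(2) y(2) by simp_all
  note arcs' = arcs[THEN G.arcs_symmetric]
  \<comment> \<open>Every pair other than u, v is joined by an arc, and there are no loops.\<close>
  have "distinct [u, v, x, y]"
    using uv arcs[THEN G.pair_no_loops] by auto
  then have "card {u, v, x, y} = 4"
    by simp
  then show ?thesis
    using arcs arcs' uv x(2) y(2) pair_graph_add_edge[OF G, of u v]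
    by (subst contains_complete_iff, simp, intro exI[of _ "{u, v, x, y}"])
      (auto simp: add_edge_def simp del: mem_parcs_circulant)
qed

lemma add_edge_commute: "add_edge G u v = add_edge G v u"
  by (simp add: add_edge_def insert_commute)

lemma complete_saturated_circulant:
  assumes "0 < a" "8 * a - 2 \<le> int n" "int n \<le> 10 * a - 3"
    and G: "pair_graph (circulant n (two_arcs a (int n)))"
  shows "complete_saturated 4 (circulant n (two_arcs a (int n)))"
proof -
  let ?D = "two_arcs a (int n)"
  interpret G: pair_graph "circulant n ?D" by (rule G)
  have D: "?D \<subseteq> {0<..<int n}"
    using assms(1,2) by (auto simp: two_arcs_def)
  have short: "contains_complete 4 (add_edge (circulant n ?D) u v)"
    if uv: "u < n" "v < n" "u \<noteq> v" "(u, v) \<notin> parcs (circulant n ?D)"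
      and d: "2 * ((int v - int u) mod int n) \<le> int n" for u v
  proof -
    let ?d = "(int v - int u) mod int n"
    have "?d \<noteq> 0"
      using uv by (auto simp: mod_eq_0_iff_dvd mod_eq_dvd_iff[symmetric])
    then have "0 < ?d"
      using uv(1) by (simp add: order_less_le)
    moreover have "?d \<notin> ?D"
      using uv by simp
    ultimately obtain b c where "b \<in> ?D" "c \<in> ?D" "c - b \<in> ?D"
      "(?d - b) mod int n \<in> ?D" "(?d - c) mod int n \<in> ?D"
      using two_arcs_saturating_pair[OF assms(1-3), of ?d] d by blast
    moreover from this have "(c - b) mod int n \<in> ?D"
      using D by auto
    ultimately show ?thesis
      by (intro circulant_add_edge_K4[OF G D uv(1-3), of b c]) (simp_all add: mod_simps)
  qed
  have "contains_complete 4 (add_edge (circulant n ?D) u v)"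
    if uv: "u < n" "v < n" "u \<noteq> v" "(u, v) \<notin> parcs (circulant n ?D)" for u v
  proof (cases "2 * ((int v - int u) mod int n) \<le> int n")
    case True
    then show ?thesis using short uv by blast
  next
    case False
    let ?d = "(int v - int u) mod int n"
    \<comment> \<open>Exchanging u and v replaces the distance d > n/2 by n - d < n/2 and adds the
      same edge.\<close>
    have "(int u - int v) mod int n = (- ?d) mod int n"
      by (simp add: mod_minus_eq)
    also have "\<dots> = int n - ?d"
      using False uv(1) by (intro uminus_mod_eq_diff) auto
    finally have "2 * ((int u - int v) mod int n) \<le> int n"
      using False by simp
    moreover have "(v, u) \<notin> parcs (circulant n ?D)"
      using uv(4) G.arcs_symmetric by blast
    ultimately show ?thesis
      using short[of v u] uv by (simp add: add_edge_commute del: mem_parcs_circulant)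
  qed
  then show ?thesis
    unfolding complete_saturated_def
    using circulant_no_K4[OF assms(1,2) G] by (auto simp del: mem_parcs_circulant)
qed

theorem theorem3p4:
  fixes n :: nat
  assumes "n \<ge> 36"
  shows "\<exists>G :: nat pair_pre_digraph.
           pair_graph G \<and> card (pverts G) = n \<and> regular_graph G \<and> complete_saturated 4 G"
proof (intro exI conjI)
  \<comment> \<open>The largest a with 8a - 2 \<le> n, so n \<le> 8a + 5. From n \<ge> 36 follows a
    \<ge> 4, hence 8a + 5 \<le> 10a - 3.\<close>
  define a where "a = (int n + 2) div 8"
  let ?G = "circulant n (two_arcs a (int n))"
  have a: "0 < a" "8 * a - 2 \<le> int n" "int n \<le> 10 * a - 3"
    using assms unfolding a_def by linarith+
  show G: "pair_graph ?G"
    using a two_arcs_uminus[of a "int n"] by (intro pair_graph_circulant) (auto simp: two_arcs_def)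
  show "card (pverts ?G) = n"
    by simp
  show "regular_graph ?G"
    using a by (intro regular_circulant) (auto simp: two_arcs_def)
  show "complete_saturated 4 ?G"
    using complete_saturated_circulant[OF a G] .
qed

end
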